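(* Let $\mathcal H$ be an infinite-dimensional complex Hilbert space and let $\mathbf A=(A_1,\dots,A_m)$ be an $m$-tuple of bounded self-adjoint operators on $\mathcal H$. For each positive integer $k$, let $S_k(\mathbf A)$ be the set of star centers of $\Lambda_k(\mathbf A)$. Then $$\Lambda_\infty(\mathbf A)=\bigcap_{k\ge1}S_k(\mathbf A)=\bigcap_{k\ge1}\Lambda_k(\mathbf A)=\bigcap\{W(\mathbf A+\mathbf F):\ \mathbf F\in\mathcal S(\mathcal H)^m\cap\mathcal F(\mathcal H)^m\}.$$ Consequently, $\Lambda_\infty(\mathbf A)$ is convex.
   Context: $\mathcal S(\mathcal H)$ is the set of bounded self-adjoint operators on $\mathcal H$ and $\mathcal F(\mathcal H)$ the set of finite-rank operators; for $\mathbf F=(F_1,\dots,F_m)$, $\mathbf A+\mathbf F=(A_1+F_1,\dots,A_m+F_m)$. For a positive integer $k$, $\Lambda_k(\mathbf A)=\{(a_1,\dots,a_m)\in\mathbb R^m:$ there is an orthogonal projection $P$ of rank $k$ on $\mathcal H$ with $PA_jP=a_jP$ for all $j\}$; $\Lambda_\infty(\mathbf A)$ is defined the same way with $P$ of infinite rank. $W(\mathbf B)=\{(\langle B_1x,x\rangle,\dots,\langle B_mx,x\rangle):x\in\mathcal H,\ \|x\|=1\}$ is the joint numerical range. A point $\mathbf c\in S$ is a star center of $S\subseteq\mathbb R^m$ if for every $\mathbf b\in S$ the segment joining $\mathbf c$ and $\mathbf b$ lies in $S$. *)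

theory Defs
  imports "HOL-Analysis.Analysis"
begin

text \<open>Complex inner product spaces: a real inner product space carrying a
complex scalar multiplication compatible with the real one, and a complex
inner product (linear in the first argument, conjugate symmetric) whose real
part is the underlying real inner product (so the norm is the Hilbert norm).\<close>

class complex_inner = real_inner +
  fixes cscale :: "complex \<Rightarrow> 'a \<Rightarrow> 'a"
    and cinner :: "'a \<Rightarrow> 'a \<Rightarrow> complex"
  assumes cscale_add_right: "cscale a (x + y) = cscale a x + cscale a y"
    and cscale_add_left: "cscale (a + b) x = cscale a x + cscale b x"
    and cscale_cscale: "cscale a (cscale b x) = cscale (a * b) x"
    and cscale_one: "cscale 1 x = x"
    and scaleR_cscale: "scaleR r x = cscale (complex_of_real r) x"
    and cinner_commute: "cinner x y = cnj (cinner y x)"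
    and cinner_add_left: "cinner (x + y) z = cinner x z + cinner y z"
    and cinner_cscale_left: "cinner (cscale a x) y = a * cinner x y"
    and inner_cinner: "inner x y = Re (cinner x y)"

class chilbert_space = complex_inner + complete_space

definition cspan :: "'a::complex_inner set \<Rightarrow> 'a set" where
  "cspan S = {x. \<exists>T c. finite T \<and> T \<subseteq> S \<and> x = (\<Sum>v\<in>T. cscale (c v) v)}"

definition cindependent :: "'a::complex_inner set \<Rightarrow> bool" where
  "cindependent S \<longleftrightarrow> \<not> (\<exists>T c. finite T \<and> T \<subseteq> S \<and> (\<Sum>v\<in>T. cscale (c v) v) = 0 \<and> (\<exists>v\<in>T. c v \<noteq> 0))"

definition infinite_dimensional :: "'a::complex_inner itself \<Rightarrow> bool" where
  "infinite_dimensional _ \<longleftrightarrow> \<not> (\<exists>S::'a set. finite S \<and> cspan S = UNIV)"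

definition bounded_clinear_op :: "('a::complex_inner \<Rightarrow> 'a) \<Rightarrow> bool" where
  "bounded_clinear_op f \<longleftrightarrow> (\<forall>x y. f (x + y) = f x + f y) \<and>
     (\<forall>a x. f (cscale a x) = cscale a (f x)) \<and> (\<exists>K. \<forall>x. norm (f x) \<le> norm x * K)"

definition selfadjoint :: "('a::complex_inner \<Rightarrow> 'a) \<Rightarrow> bool" where
  "selfadjoint A \<longleftrightarrow> bounded_clinear_op A \<and> (\<forall>x y. cinner (A x) y = cinner x (A y))"

definition finite_rank :: "('a::complex_inner \<Rightarrow> 'a) \<Rightarrow> bool" where
  "finite_rank F \<longleftrightarrow> bounded_clinear_op F \<and> (\<exists>S. finite S \<and> range F \<subseteq> cspan S)"

definition orth_proj :: "('a::complex_inner \<Rightarrow> 'a) \<Rightarrow> bool" where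
  "orth_proj P \<longleftrightarrow> selfadjoint P \<and> (\<forall>x. P (P x) = P x)"

definition has_rank :: "('a::complex_inner \<Rightarrow> 'a) \<Rightarrow> nat \<Rightarrow> bool" where
  "has_rank P k \<longleftrightarrow> (\<exists>B. finite B \<and> card B = k \<and> cindependent B \<and> cspan B = range P)"

definition infinite_rank :: "('a::complex_inner \<Rightarrow> 'a) \<Rightarrow> bool" where
  "infinite_rank P \<longleftrightarrow> \<not> (\<exists>S. finite S \<and> range P \<subseteq> cspan S)"

definition compress_cond :: "('a::complex_inner \<Rightarrow> 'a) \<Rightarrow> ('a \<Rightarrow> 'a)^'m \<Rightarrow> real^'m \<Rightarrow> bool" where
  "compress_cond P A a \<longleftrightarrow> (\<forall>j x. P ((A$j) (P x)) = cscale (complex_of_real (a$j)) (P x))"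

definition Lambda_k :: "nat \<Rightarrow> ('a::complex_inner \<Rightarrow> 'a)^'m \<Rightarrow> (real^'m) set" where
  "Lambda_k k A = {a. \<exists>P. orth_proj P \<and> has_rank P k \<and> compress_cond P A a}"

definition Lambda_inf :: "('a::complex_inner \<Rightarrow> 'a)^'m \<Rightarrow> (real^'m) set" where
  "Lambda_inf A = {a. \<exists>P. orth_proj P \<and> infinite_rank P \<and> compress_cond P A a}"

text \<open>Joint numerical range; for self-adjoint entries the values are real.\<close>
definition joint_nr :: "('a::complex_inner \<Rightarrow> 'a)^'m \<Rightarrow> (real^'m) set" where
  "joint_nr B = (\<lambda>x. \<chi> j. Re (cinner ((B$j) x) x)) ` {x. norm x = 1}"

definition star_centers :: "'b::real_vector set \<Rightarrow> 'b set" where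
  "star_centers S = {c \<in> S. \<forall>b\<in>S. closed_segment c b \<subseteq> S}"

end

theory Submission
  imports Defs
begin

text \<open>The chain \<open>\<Lambda>\<^sub>\<infinity> \<subseteq> \<Inter>S\<^sub>k \<subseteq> \<Inter>\<Lambda>\<^sub>k \<subseteq> \<Inter>W(A + F) \<subseteq> \<Lambda>\<^sub>\<infinity>\<close> closes up. For the first inclusion, let
  \<open>e\<^sub>i\<close> be an orthonormal \<open>k\<close>-family realising \<open>b \<in> \<Lambda>\<^sub>k\<close>; the infinite-dimensional space realising \<open>a \<in> \<Lambda>\<^sub>\<infinity>\<close>
  contains an orthonormal \<open>k\<close>-family \<open>f\<^sub>i\<close> orthogonal to all \<open>e\<^sub>l\<close> and \<open>A\<^sub>j e\<^sub>l\<close>, and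
  \<open>sqrt (1 - u) f\<^sub>i + sqrt u e\<^sub>i\<close> realises \<open>(1 - u) a + u b\<close>. The third holds because a space of large
  dimension meets the kernel of every finite-rank \<open>F\<close>. For the last, let \<open>a\<close> lie in every \<open>W(A + F)\<close>
  and take a maximal subspace \<open>M\<close> to which \<open>A\<close> compresses as the scalar tuple \<open>a\<close>; it is closed, and if it were
  finite-dimensional, suitable \<open>F\<close> would yield a unit vector \<open>x\<close> orthogonal to \<open>M\<close> and
  all \<open>A\<^sub>j M\<close> with \<open>\<langle>A\<^sub>j x, x\<rangle> = a\<^sub>j\<close>, so that \<open>M\<close> could be enlarged.\<close>

section \<open>Complex inner product spaces\<close>

interpretation cv: vector_space "cscale :: complex \<Rightarrow> 'a::complex_inner \<Rightarrow> 'a"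
  by unfold_locales (simp_all add: cscale_add_right cscale_add_left cscale_cscale cscale_one)

lemma cspan_eq_span: "cspan S = cv.span S"
  unfolding cspan_def cv.span_explicit by auto

lemma cindependent_eq_independent: "cindependent S \<longleftrightarrow> cv.independent S"
  unfolding cindependent_def cv.dependent_explicit by auto

lemma cinner_add_right: "cinner x (y + z) = cinner x y + cinner x z"
  by (metis cinner_add_left cinner_commute complex_cnj_add)

lemma cinner_cscale_right: "cinner x (cscale a y) = cnj a * cinner x y"
  by (metis cinner_cscale_left cinner_commute complex_cnj_mult)

lemma cinner_zero_left [simp]: "cinner 0 y = 0"
  using cinner_add_left[of 0 0 y] by simp

lemma cinner_zero_right [simp]: "cinner y 0 = 0"
  using cinner_add_right[of y 0 0] by simp

lemma cinner_minus_left: "cinner (- x) y = - cinner x y"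
  using cinner_add_left[of x "- x" y] by (simp add: eq_neg_iff_add_eq_0 add.commute)

lemma cinner_minus_right: "cinner x (- y) = - cinner x y"
  using cinner_add_right[of x y "- y"] by (simp add: eq_neg_iff_add_eq_0 add.commute)

lemma cinner_diff_left: "cinner (x - y) z = cinner x z - cinner y z"
  using cinner_add_left[of x "- y" z] by (simp add: cinner_minus_left)

lemma cinner_diff_right: "cinner x (y - z) = cinner x y - cinner x z"
  using cinner_add_right[of x y "- z"] by (simp add: cinner_minus_right)

lemmas cinner_algebra =
  cinner_add_left cinner_add_right cinner_diff_left cinner_diff_right
  cinner_cscale_left cinner_cscale_right

lemma cinner_sum_left: "cinner (\<Sum>i\<in>I. f i) y = (\<Sum>i\<in>I. cinner (f i) y)"
  by (induction I rule: infinite_finite_induct) (auto simp: cinner_add_left)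

lemma cinner_eq_0_commute: "cinner x y = 0 \<longleftrightarrow> cinner y x = 0"
  by (metis cinner_commute complex_cnj_zero)

lemma cinner_self: "cinner x x = complex_of_real ((norm x)\<^sup>2)"
proof (rule complex_eqI)
  show "Re (cinner x x) = Re (complex_of_real ((norm x)\<^sup>2))"
    using inner_cinner[of x x] by (simp add: power2_norm_eq_inner)
  have "Im (cinner x x) = - Im (cinner x x)"
    by (metis cinner_commute cnj.sel(2))
  then show "Im (cinner x x) = Im (complex_of_real ((norm x)\<^sup>2))" by simp
qed

lemma cinner_self_eq_0 [simp]: "cinner x x = 0 \<longleftrightarrow> x = 0"
  by (simp add: cinner_self)

text \<open>Reduces the complex inner product to the real one: limits of \<open>cinner\<close>
  follow from limits of \<open>inner\<close>, and real orthogonality to \<open>y\<close> and to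
  \<open>cscale \<i> y\<close> together give complex orthogonality.\<close>

lemma cinner_eq_Complex: "cinner x y = Complex (inner x y) (inner x (cscale \<i> y))"
  by (rule complex_eqI) (simp_all add: inner_cinner cinner_cscale_right)

lemma norm_cscale: "norm (cscale c x) = cmod c * norm x"
proof -
  have "complex_of_real ((norm (cscale c x))\<^sup>2) = c * cnj c * cinner x x"
    unfolding cinner_self[symmetric] by (simp add: cinner_algebra)
  also have "\<dots> = complex_of_real ((cmod c * norm x)\<^sup>2)"
    by (simp add: cinner_self complex_norm_square[symmetric] power_mult_distrib)
  finally have "(norm (cscale c x))\<^sup>2 = (cmod c * norm x)\<^sup>2"
    using of_real_eq_iff by blast
  then show ?thesis by (simp add: power2_eq_iff_nonneg)
qed

lemma bounded_linear_cscale: "bounded_linear (cscale c :: 'a::complex_inner \<Rightarrow> 'a)"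
proof (rule bounded_linear_intro)
  show "cscale c (r *\<^sub>R x) = r *\<^sub>R cscale c x" for r and x :: 'a
    by (simp add: scaleR_cscale mult.commute)
  show "norm (cscale c x) \<le> norm x * cmod c" for x :: 'a
    by (simp add: norm_cscale mult.commute)
qed (rule cscale_add_right)

lemma tendsto_cinner:
  fixes f g :: "'b \<Rightarrow> 'a::complex_inner"
  assumes "(f \<longlongrightarrow> x) F" "(g \<longlongrightarrow> y) F"
  shows "((\<lambda>n. cinner (f n) (g n)) \<longlongrightarrow> cinner x y) F"
  unfolding cinner_eq_Complex
  by (intro tendsto_Complex tendsto_inner assms bounded_linear.tendsto[OF bounded_linear_cscale])

lemma norm_add_cinner_0:
  assumes "cinner x y = 0"
  shows "(norm (x + y))\<^sup>2 = (norm x)\<^sup>2 + (norm y)\<^sup>2"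
proof -
  have "inner x y = 0" by (simp add: inner_cinner assms)
  then show ?thesis by (simp add: power2_norm_eq_inner inner_add inner_commute)
qed

lemma cinner_0_on_span:
  assumes "x \<in> cv.span T" "\<And>t. t \<in> T \<Longrightarrow> cinner z t = 0"
  shows "cinner z x = 0"
  using assms(1) by (induction rule: cv.span_induct_alt) (auto simp: assms(2) cinner_algebra)

lemma bounded_clinear_op_bounded_linear:
  assumes "bounded_clinear_op A" shows "bounded_linear A"
  using assms unfolding bounded_clinear_op_def
  by (auto intro: bounded_linear_intro simp: scaleR_cscale)

lemma selfadjoint_add: "selfadjoint A \<Longrightarrow> A (x + y) = A x + A y"
  and selfadjoint_cscale: "selfadjoint A \<Longrightarrow> A (cscale c x) = cscale c (A x)"
  and selfadjoint_cinner: "selfadjoint A \<Longrightarrow> cinner (A x) y = cinner x (A y)"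
  by (simp_all add: selfadjoint_def bounded_clinear_op_def)

lemma selfadjoint_bounded_linear: "selfadjoint A \<Longrightarrow> bounded_linear A"
  by (simp add: bounded_clinear_op_bounded_linear selfadjoint_def)

lemma selfadjoint_0: "selfadjoint A \<Longrightarrow> A 0 = 0"
  by (simp add: selfadjoint_bounded_linear linear_simps(3))

lemma selfadjoint_diff: "selfadjoint A \<Longrightarrow> A (x - y) = A x - A y"
  by (simp add: selfadjoint_bounded_linear linear_simps(2))

lemma selfadjoint_cinner_real:
  assumes "selfadjoint A"
  shows "cinner (A x) x = complex_of_real (Re (cinner (A x) x))"
proof -
  have "cinner (A x) x = cnj (cinner (A x) x)"
    by (metis assms cinner_commute selfadjoint_cinner)
  then have "Im (cinner (A x) x) = - Im (cinner (A x) x)"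
    by (metis cnj.sel(2))
  then show ?thesis by (simp add: complex_eq_iff)
qed

section \<open>Orthogonal projections\<close>

text \<open>The component in \<open>M\<close> is unique, because the difference of two candidates
  lies in \<open>M\<close> and is orthogonal to \<open>M\<close>, hence to itself. Uniqueness makes
  \<open>P\<close> linear, and Pythagoras bounds its norm by 1. Serves for finite spans and for
  closed subspaces.\<close>

lemma orth_proj_exists:
  fixes M :: "'a::complex_inner set"
  assumes M: "cv.subspace M"
    and ex: "\<And>x. \<exists>p\<in>M. \<forall>y\<in>M. cinner (x - p) y = 0"
  obtains P where "orth_proj P" "range P = M"
proof -
  obtain P where PM: "\<And>x. P x \<in> M" and P0: "\<And>x y. y \<in> M \<Longrightarrow> cinner (x - P x) y = 0"
    using ex by metis
  have uniq: "P x = p" if "p \<in> M" "\<And>y. y \<in> M \<Longrightarrow> cinner (x - p) y = 0" for x p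
  proof -
    have d: "P x - p \<in> M" using M PM that(1) by (simp add: cv.subspace_diff)
    have "cinner (P x - p) (P x - p) = cinner (x - p) (P x - p) - cinner (x - P x) (P x - p)"
      by (simp add: cinner_diff_left)
    then show ?thesis using d that(2) P0 by simp
  qed
  have add: "P (x + y) = P x + P y" for x y
  proof (rule uniq)
    show "P x + P y \<in> M" using M PM by (simp add: cv.subspace_add)
    show "cinner (x + y - (P x + P y)) z = 0" if "z \<in> M" for z
      using P0[OF that, of x] P0[OF that, of y] by (simp add: cinner_algebra)
  qed
  have scale: "P (cscale c x) = cscale c (P x)" for c x
  proof (rule uniq)
    show "cscale c (P x) \<in> M" using M PM by (simp add: cv.subspace_scale)
    show "cinner (cscale c x - cscale c (P x)) z = 0" if "z \<in> M" for z
      using P0[OF that, of x] by (simp add: cinner_algebra)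
  qed
  have "norm (P x) \<le> norm x" for x
  proof -
    have "(norm ((x - P x) + P x))\<^sup>2 = (norm (x - P x))\<^sup>2 + (norm (P x))\<^sup>2"
      by (rule norm_add_cinner_0) (simp add: P0 PM)
    then have "(norm (P x))\<^sup>2 \<le> (norm x)\<^sup>2" by simp
    then show ?thesis by (simp add: power2_le_iff_abs_le)
  qed
  then have "bounded_clinear_op P"
    unfolding bounded_clinear_op_def using add scale by (auto intro: exI[of _ 1])
  moreover have "cinner (P x) y = cinner x (P y)" for x y
  proof -
    have "cinner (y - P y) (P x) = 0" "cinner (x - P x) (P y) = 0" by (simp_all add: P0 PM)
    then have "cinner (P x) (y - P y) = 0" "cinner (x - P x) (P y) = 0"
      by (simp_all add: cinner_eq_0_commute)
    then show ?thesis by (simp add: cinner_algebra)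
  qed
  moreover have id: "P x = x" if "x \<in> M" for x
    by (rule uniq) (simp_all add: that)
  ultimately have "orth_proj P"
    unfolding orth_proj_def selfadjoint_def using PM by auto
  moreover have "range P = M"
  proof
    show "range P \<subseteq> M" using PM by blast
    show "M \<subseteq> range P" using id by (metis rangeI subsetI)
  qed
  ultimately show thesis by (rule that)
qed

lemma orth_proj_cinner_diff:
  assumes "orth_proj P" shows "cinner (x - P x) (P y) = 0"
proof -
  have "cinner (x - P x) (P y) = cinner (P (x - P x)) y"
    using assms by (simp add: orth_proj_def selfadjoint_cinner)
  also have "P (x - P x) = 0"
    using assms by (simp add: orth_proj_def selfadjoint_diff)
  finally show ?thesis by simp
qed

lemma orth_proj_range_subspace:
  assumes "orth_proj P" shows "cv.subspace (range P)"
proof -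
  have P: "selfadjoint P" using assms by (simp add: orth_proj_def)
  show ?thesis
    unfolding cv.subspace_def
  proof (intro conjI ballI allI)
    show "0 \<in> range P" by (rule range_eqI[of _ _ 0]) (simp add: P selfadjoint_0)
    fix x y c assume "x \<in> range P" "y \<in> range P"
    then obtain u v where "x = P u" "y = P v" by blast
    then show "x + y \<in> range P" "cscale c x \<in> range P"
      by (auto simp: P selfadjoint_add[symmetric] selfadjoint_cscale[symmetric])
  qed
qed

text \<open>Gram-Schmidt as an induction on \<open>T\<close>: orthogonality is tracked only on the
  generators and extended to the span at the end.\<close>

lemma finite_span_nearest:
  assumes "finite T"
  shows "\<exists>p\<in>cv.span T. \<forall>y\<in>cv.span T. cinner (x - p) y = 0"
proof -
  have "\<exists>p\<in>cv.span T. \<forall>t\<in>T. cinner (x - p) t = 0" for x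
    using assms
  proof (induction T arbitrary: x rule: finite_induct)
    case empty
    then show ?case by simp
  next
    case (insert t T)
    obtain p where p: "p \<in> cv.span T" "\<And>s. s \<in> T \<Longrightarrow> cinner (x - p) s = 0"
      using insert.IH[of x] by blast
    obtain q where q: "q \<in> cv.span T" "\<And>s. s \<in> T \<Longrightarrow> cinner (t - q) s = 0"
      using insert.IH[of t] by blast
    \<comment> \<open>\<open>w\<close> is the part of the new generator orthogonal to the old span,
      and \<open>c\<close> is the coefficient of \<open>x\<close> along it. If \<open>w = 0\<close>,
      division by zero makes \<open>c = 0\<close>, and \<open>xw\<close> still holds.\<close>
    define w where "w = t - q"
    define c where "c = cinner x w / cinner w w"
    have wp: "cinner w p = 0" and wq: "cinner w q = 0"
      unfolding w_def using cinner_0_on_span p(1) q by blast+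
    have xw: "cinner x w = c * cinner w w"
      by (cases "w = 0") (simp_all add: c_def)
    have xq: "cinner (x - p) q = 0"
      using cinner_0_on_span p q(1) by blast
    have "p + cscale c w \<in> cv.span (insert t T)"
      unfolding w_def
      by (intro cv.span_add cv.span_scale cv.span_diff)
        (use p(1) q(1) cv.span_mono[of T "insert t T"] in \<open>auto intro: cv.span_base\<close>)
    moreover have "cinner (x - (p + cscale c w)) s = 0" if "s \<in> T" for s
      using p(2)[OF that] q(2)[OF that] by (simp add: cinner_algebra w_def[symmetric])
    \<comment> \<open>The new generator is \<open>t = w + q\<close>; \<open>c\<close> was chosen to
      cancel the \<open>w\<close> part.\<close>
    moreover have "cinner (x - (p + cscale c w)) (w + q) = 0"
      using xq wq wp xw cinner_eq_0_commute[of p w] by (simp add: cinner_algebra)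
    then have "cinner (x - (p + cscale c w)) t = 0" by (simp add: w_def)
    ultimately show ?case by blast
  qed
  then show ?thesis using cinner_0_on_span by blast
qed

lemma orth_proj_finite_span:
  assumes "finite T"
  obtains P where "orth_proj P" "range P = cv.span T"
  using orth_proj_exists[OF cv.subspace_span finite_span_nearest[OF assms]] by blast

section \<open>Projections onto closed subspaces of a Hilbert space\<close>

lemma subspace_imp_real_subspace:
  assumes "cv.subspace M" shows "subspace M"
  using assms by (simp add: cv.subspace_def subspace_def scaleR_cscale)

text \<open>A minimising sequence is Cauchy: midpoints stay in \<open>M\<close>, hence at distance
  at least \<open>d\<close> from \<open>x\<close>, and the parallelogram law then bounds the
  distance of two terms.\<close>

lemma closed_convex_closest_point:
  fixes M :: "'a::{real_inner, complete_space} set"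
  assumes "closed M" "convex M" "M \<noteq> {}"
  shows "\<exists>p\<in>M. \<forall>y\<in>M. dist x p \<le> dist x y"
proof -
  define d where "d = infdist x M"
  have d: "d \<le> dist x y" if "y \<in> M" for y
    unfolding d_def using that by (rule infdist_le)
  have d0: "0 \<le> d" by (simp add: d_def infdist_nonneg)
  have "\<exists>y\<in>M. dist x y < d + 1 / real (Suc n)" for n
    using \<open>M \<noteq> {}\<close> cInf_lessD[of "dist x ` M" "d + 1 / real (Suc n)"]
    by (auto simp: d_def infdist_notempty)
  then obtain f where fM: "\<And>n. f n \<in> M" and f: "\<And>n. dist x (f n) < d + 1 / real (Suc n)"
    by metis
  \<comment> \<open>The square of \<open>1 / real (Suc n)\<close> is at most the number itself, so
    the error stays linear in it.\<close>
  have f2: "(dist x (f n))\<^sup>2 \<le> d\<^sup>2 + (2 * d + 1) * (1 / real (Suc n))" for n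
  proof -
    have "(dist x (f n))\<^sup>2 \<le> (d + 1 / real (Suc n))\<^sup>2"
      using f[of n] by (intro power_mono) auto
    also have "\<dots> = d\<^sup>2 + 2 * d * (1 / real (Suc n)) + (1 / real (Suc n)) * (1 / real (Suc n))"
      by (simp add: power2_eq_square algebra_simps)
    also have "\<dots> \<le> d\<^sup>2 + 2 * d * (1 / real (Suc n)) + 1 * (1 / real (Suc n))"
      by (intro add_left_mono mult_right_mono) auto
    finally show ?thesis by (simp add: algebra_simps)
  qed
  have f3: "(dist (f m) (f n))\<^sup>2 \<le> 2 * (2 * d + 1) * (1 / real (Suc m) + 1 / real (Suc n))" for m n
  proof -
    define z where "z = (1/2) *\<^sub>R f m + (1/2) *\<^sub>R f n"
    have "z \<in> M"
      unfolding z_def by (rule convexD[OF \<open>convex M\<close> fM fM]) auto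
    then have "d\<^sup>2 \<le> (dist x z)\<^sup>2" using d d0 by (simp add: power_mono)
    moreover have "(dist (f m) (f n))\<^sup>2 + 4 * (dist x z)\<^sup>2 = 2 * (dist x (f m))\<^sup>2 + 2 * (dist x (f n))\<^sup>2"
      unfolding z_def dist_norm power2_norm_eq_inner
      by (simp add: inner_add inner_diff inner_commute algebra_simps)
    moreover have "2 * (2 * d + 1) * (a + b) = 2 * ((2 * d + 1) * a) + 2 * ((2 * d + 1) * b)" for a b
      by (simp add: algebra_simps)
    ultimately show ?thesis using f2[of m] f2[of n] by (smt (verit))
  qed
  have "Cauchy f"
  proof (rule metric_CauchyI)
    fix e :: real assume "0 < e"
    have "(\<lambda>n. 4 * (2 * d + 1) * (1 / real (Suc n))) \<longlonglongrightarrow> 4 * (2 * d + 1) * 0"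
      by (intro tendsto_intros LIMSEQ_Suc[OF lim_1_over_n])
    then have "\<forall>\<^sub>F n in sequentially. 4 * (2 * d + 1) * (1 / real (Suc n)) < e\<^sup>2"
      by (rule order_tendstoD(2)) (use \<open>0 < e\<close> in simp)
    then obtain N where N: "4 * (2 * d + 1) * (1 / real (Suc N)) < e\<^sup>2"
      unfolding eventually_sequentially by blast
    have "dist (f m) (f n) < e" if "m \<ge> N" "n \<ge> N" for m n
    proof -
      have "1 / real (Suc m) \<le> 1 / real (Suc N)" "1 / real (Suc n) \<le> 1 / real (Suc N)"
        using that by (auto intro: divide_left_mono)
      then have "2 * (2 * d + 1) * (1 / real (Suc m) + 1 / real (Suc n))
        \<le> 2 * (2 * d + 1) * (1 / real (Suc N) + 1 / real (Suc N))"
        using d0 by (intro mult_left_mono add_mono) auto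
      then have "(dist (f m) (f n))\<^sup>2 < e\<^sup>2" using f3[of m n] N by simp
      then show ?thesis using \<open>0 < e\<close> by (simp add: power_less_imp_less_base)
    qed
    then show "\<exists>N. \<forall>m\<ge>N. \<forall>n\<ge>N. dist (f m) (f n) < e" by blast
  qed
  then obtain p where p: "f \<longlonglongrightarrow> p" unfolding Cauchy_convergent_iff convergent_def by blast
  have "p \<in> M" using closed_sequentially[OF \<open>closed M\<close> fM p] .
  moreover have "dist x p \<le> d"
  proof (rule LIMSEQ_le)
    show "(\<lambda>n. dist x (f n)) \<longlonglongrightarrow> dist x p" by (intro tendsto_intros p)
    show "(\<lambda>n. d + 1 / real (Suc n)) \<longlonglongrightarrow> d"
      using tendsto_add[OF tendsto_const LIMSEQ_Suc[OF lim_1_over_n], of d] by simp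
    show "\<exists>N. \<forall>n\<ge>N. dist x (f n) \<le> d + 1 / real (Suc n)" using f less_imp_le by blast
  qed
  ultimately show ?thesis using d by (meson order_trans)
qed

text \<open>The variational inequality at the closest point \<open>p\<close>, tested on
  \<open>p + y\<close> and \<open>p - y\<close>, gives real orthogonality; testing
  \<open>cscale \<i> y\<close> as well gives the imaginary part.\<close>

lemma orth_proj_closed_subspace:
  fixes M :: "'a::chilbert_space set"
  assumes "cv.subspace M" "closed M"
  obtains P where "orth_proj P" "range P = M"
proof (rule orth_proj_exists[OF assms(1)])
  fix x :: 'a
  have cM: "convex M"
    by (simp add: assms(1) subspace_imp_real_subspace subspace_imp_convex)
  obtain p where p: "p \<in> M" "\<forall>y\<in>M. dist x p \<le> dist x y"
    using closed_convex_closest_point[OF assms(2) cM] cv.subspace_0[OF assms(1)] by blast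
  have le: "inner (x - p) y \<le> 0" if "y \<in> M" for y
    using any_closest_point_dot[OF cM assms(2) p(1) _ p(2), of "p + y"] that p(1) assms(1)
    by (simp add: cv.subspace_add)
  have eq: "inner (x - p) y = 0" if "y \<in> M" for y
    using le[OF that] le[of "- y"] that assms(1) by (simp add: cv.subspace_neg)
  have "cinner (x - p) y = 0" if "y \<in> M" for y
    using eq[OF that] eq[of "cscale \<i> y"] that assms(1)
    by (simp add: cinner_eq_Complex cv.subspace_scale Complex_eq_0)
  then show "\<exists>p\<in>M. \<forall>y\<in>M. cinner (x - p) y = 0" using p(1) by blast
qed

section \<open>Orthonormal families and compressions\<close>

text \<open>A lower bound for the dimension that chooses no basis and so also covers
  infinite-dimensional \<open>M\<close>; it is vacuous for \<open>k = 0\<close>.\<close>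

definition dim_ge :: "'a::complex_inner set \<Rightarrow> nat \<Rightarrow> bool" where
  "dim_ge M k \<longleftrightarrow> (\<forall>S. finite S \<and> card S < k \<longrightarrow> \<not> M \<subseteq> cv.span S)"

definition orthocomp :: "'a::complex_inner set \<Rightarrow> 'a set" where
  "orthocomp T = {x. \<forall>t\<in>T. cinner x t = 0}"

definition orthonormal :: "nat \<Rightarrow> (nat \<Rightarrow> 'a::complex_inner) \<Rightarrow> bool" where
  "orthonormal k e \<longleftrightarrow> (\<forall>i<k. \<forall>l<k. cinner (e i) (e l) = (if i = l then 1 else 0))"

text \<open>Replaces a projection of rank \<open>k\<close> by an orthonormal basis of its range,
  which turns the compression condition into finitely many scalar equations; see
  \<open>Lambda_k_iff_family\<close>.\<close>

definition compress_family ::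
  "nat \<Rightarrow> (nat \<Rightarrow> 'a::complex_inner) \<Rightarrow> ('a \<Rightarrow> 'a)^'m \<Rightarrow> real^'m \<Rightarrow> bool" where
  "compress_family k e A a \<longleftrightarrow> orthonormal k e \<and>
    (\<forall>j. \<forall>i<k. \<forall>l<k. cinner ((A$j) (e i)) (e l) = (if i = l then complex_of_real (a$j) else 0))"

lemma orthocomp_subspace: "cv.subspace (orthocomp T)"
  by (auto simp: cv.subspace_def orthocomp_def cinner_algebra)

lemma orthocomp_Un: "orthocomp (S \<union> T) = orthocomp S \<inter> orthocomp T"
  by (auto simp: orthocomp_def)

text \<open>A vector of \<open>M\<close> not orthogonal to \<open>t\<close> spans \<open>M\<close> together with the vectors of \<open>M\<close>
  orthogonal to \<open>t\<close>.\<close>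

lemma dim_ge_orthocomp_single:
  assumes M: "cv.subspace M" and d: "dim_ge M (Suc k)"
  shows "dim_ge (M \<inter> orthocomp {t}) k"
  unfolding dim_ge_def
proof (intro allI impI notI)
  fix S assume S: "finite S \<and> card S < k" and sub: "M \<inter> orthocomp {t} \<subseteq> cv.span S"
  show False
  proof (cases "M \<subseteq> orthocomp {t}")
    case True
    then have "M \<subseteq> cv.span S" using sub by blast
    then show False using d S unfolding dim_ge_def by (meson less_SucI)
  next
    case False
    then obtain u where u: "u \<in> M" "cinner u t \<noteq> 0" by (auto simp: orthocomp_def)
    have "x \<in> cv.span (insert u S)" if "x \<in> M" for x
    proof -
      have "x - cscale (cinner x t / cinner u t) u \<in> M \<inter> orthocomp {t}"
        using M u that by (simp add: orthocomp_def cv.subspace_diff cv.subspace_scale cinner_algebra)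
      then show ?thesis using sub cv.span_breakdown_eq by blast
    qed
    then have "M \<subseteq> cv.span (insert u S)" by blast
    moreover have "card (insert u S) < Suc k" using S by (auto simp: card_insert_if)
    ultimately show False using d S unfolding dim_ge_def by blast
  qed
qed

lemma dim_ge_orthocomp:
  assumes "finite T" "cv.subspace M" "dim_ge M (k + card T)"
  shows "dim_ge (M \<inter> orthocomp T) k"
  using assms
proof (induction T arbitrary: k rule: finite_induct)
  case empty
  then show ?case by (simp add: orthocomp_def)
next
  case (insert t T)
  have "dim_ge (M \<inter> orthocomp T) (Suc k)"
    using insert by simp
  then have "dim_ge ((M \<inter> orthocomp T) \<inter> orthocomp {t}) k"
    by (rule dim_ge_orthocomp_single[OF cv.subspace_inter[OF insert.prems(1) orthocomp_subspace]])
  then show ?case by (simp add: orthocomp_def Int_def conj_ac)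
qed

lemma dim_ge_unit_vector:
  assumes M: "cv.subspace M" and d: "dim_ge M k" and "k > 0"
  shows "\<exists>x\<in>M. norm x = 1"
proof -
  have "\<not> M \<subseteq> cv.span {}"
    using d \<open>k > 0\<close> unfolding dim_ge_def by (metis card.empty finite.emptyI)
  then obtain y where y: "y \<in> M" "y \<noteq> 0" by auto
  define x where "x = cscale (complex_of_real (1 / norm y)) y"
  have "norm x = 1" using y(2) by (simp add: x_def norm_cscale norm_divide)
  moreover have "x \<in> M" unfolding x_def by (rule cv.subspace_scale[OF M y(1)])
  ultimately show ?thesis by blast
qed

text \<open>Vectors are added one at a time. Of the \<open>Suc k + card T\<close> dimensions,
  \<open>T\<close> costs at most \<open>card T\<close> and the vectors already chosen at most
  \<open>k\<close>, so one is left for the next vector.\<close>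

lemma orthonormal_in_orthocomp:
  assumes M: "cv.subspace M" and T: "finite T" and d: "dim_ge M (k + card T)"
  shows "\<exists>e. orthonormal k e \<and> (\<forall>i<k. e i \<in> M \<inter> orthocomp T)"
  using d
proof (induction k)
  case 0
  then show ?case by (simp add: orthonormal_def)
next
  case (Suc k)
  have "dim_ge M (k + card T)"
    using Suc.prems unfolding dim_ge_def by (metis add_Suc less_SucI)
  then obtain e where e: "orthonormal k e" "\<And>i. i < k \<Longrightarrow> e i \<in> M \<inter> orthocomp T"
    using Suc.IH by blast
  define N where "N = M \<inter> orthocomp T"
  have N: "cv.subspace N" unfolding N_def by (intro cv.subspace_inter M orthocomp_subspace)
  have "dim_ge N (Suc k)" unfolding N_def by (rule dim_ge_orthocomp[OF T M Suc.prems])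
  then have "dim_ge N (Suc 0 + card (e ` {..<k}))"
    using card_image_le[of "{..<k}" e] unfolding dim_ge_def by auto
  then have "dim_ge (N \<inter> orthocomp (e ` {..<k})) (Suc 0)"
    by (intro dim_ge_orthocomp[OF _ N]) auto
  then obtain x where x: "x \<in> N" "x \<in> orthocomp (e ` {..<k})" "norm x = 1"
    using dim_ge_unit_vector[OF cv.subspace_inter[OF N orthocomp_subspace]] by blast
  have xe: "cinner x (e i) = 0" "cinner (e i) x = 0" if "i < k" for i
    using x(2) that cinner_eq_0_commute by (auto simp: orthocomp_def)
  have xx: "cinner x x = 1" using x(3) by (simp add: cinner_self)
  have "orthonormal (Suc k) (e(k := x))"
    using e(1) xe xx by (auto simp: orthonormal_def less_Suc_eq)
  moreover have "\<forall>i<Suc k. (e(k := x)) i \<in> M \<inter> orthocomp T"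
    using e(2) x(1) by (auto simp: less_Suc_eq N_def)
  ultimately show ?case by blast
qed

lemma has_rank_dim_ge:
  assumes "has_rank P k" shows "dim_ge (range P) k"
proof -
  obtain B where B: "finite B" "card B = k" "cv.independent B" "cv.span B = range P"
    using assms unfolding has_rank_def cspan_eq_span cindependent_eq_independent by blast
  show ?thesis
    unfolding dim_ge_def
  proof (intro allI impI notI)
    fix S assume S: "finite S \<and> card S < k" "range P \<subseteq> cv.span S"
    then have "B \<subseteq> cv.span S" using B(4) cv.span_superset by blast
    then show False using cv.independent_span_bound[of S B] S B by auto
  qed
qed

lemma infinite_rank_dim_ge: "infinite_rank P \<Longrightarrow> dim_ge (range P) k"
  unfolding infinite_rank_def dim_ge_def cspan_eq_span by blast

lemma compress_cond_cinner:
  assumes "orth_proj P" "compress_cond P A a" "x \<in> range P" "y \<in> range P"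
  shows "cinner ((A$j) x) y = complex_of_real (a$j) * cinner x y"
proof -
  have P: "selfadjoint P" "\<And>z. P (P z) = P z" using assms(1) by (auto simp: orth_proj_def)
  have x: "P x = x" and y: "P y = y" using assms(3,4) P(2) by auto
  have "cinner ((A$j) x) y = cinner (P ((A$j) (P x))) y"
    using selfadjoint_cinner[OF P(1), of "(A$j) x" y] x y by simp
  also have "\<dots> = complex_of_real (a$j) * cinner x y"
    using assms(2)[unfolded compress_cond_def, rule_format, of j x] by (simp add: x cinner_cscale_left)
  finally show ?thesis .
qed

lemma compress_cond_iff:
  assumes "orth_proj P"
  shows "compress_cond P A a \<longleftrightarrow>
    (\<forall>j. \<forall>x\<in>range P. \<forall>y\<in>range P. cinner ((A$j) x) y = complex_of_real (a$j) * cinner x y)"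
proof (intro iffI allI ballI)
  assume *: "\<forall>j. \<forall>x\<in>range P. \<forall>y\<in>range P. cinner ((A$j) x) y = complex_of_real (a$j) * cinner x y"
  have P: "selfadjoint P" "\<And>z. P (P z) = P z" using assms by (auto simp: orth_proj_def)
  show "compress_cond P A a"
    unfolding compress_cond_def
  proof (intro allI)
    fix j x
    \<comment> \<open>The defect \<open>w\<close> itself lies in \<open>range P\<close>, so testing
      the hypothesis against \<open>w\<close> gives \<open>cinner w w = 0\<close>.\<close>
    define w where "w = P ((A$j) (P x)) - cscale (complex_of_real (a$j)) (P x)"
    have "w = P w"
      unfolding w_def by (simp add: P selfadjoint_diff selfadjoint_cscale)
    then have w: "w \<in> range P" by (rule range_eqI)
    have "cinner (P ((A$j) (P x))) w = cinner ((A$j) (P x)) w"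
      using selfadjoint_cinner[OF P(1)] \<open>w = P w\<close> by simp
    also have "\<dots> = complex_of_real (a$j) * cinner (P x) w" using * w by blast
    finally have "cinner w w = 0"
      by (subst w_def) (simp add: cinner_algebra)
    then show "P ((A$j) (P x)) = cscale (complex_of_real (a$j)) (P x)" by (simp add: w_def)
  qed
qed (use compress_cond_cinner[OF assms] in blast)

text \<open>The surplus of \<open>card T\<close> dimensions pays for orthogonality to
  \<open>T\<close>. Taking \<open>T\<close> empty gives plain families; other choices of
  \<open>T\<close> remove cross terms or reach the kernel of a finite-rank operator.\<close>

lemma range_orth_proj_family:
  assumes P: "orth_proj P" "compress_cond P A a" and "finite T" "dim_ge (range P) (k + card T)"
  shows "\<exists>e. compress_family k e A a \<and> (\<forall>i<k. e i \<in> orthocomp T)"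
proof -
  obtain e where e: "orthonormal k e" "\<And>i. i < k \<Longrightarrow> e i \<in> range P \<inter> orthocomp T"
    using orthonormal_in_orthocomp[OF orth_proj_range_subspace[OF P(1)] assms(3,4)] by blast
  have "cinner ((A$j) (e i)) (e l) = (if i = l then complex_of_real (a$j) else 0)"
    if "i < k" "l < k" for i j l
    using compress_cond_cinner[OF P, of "e i" "e l" j] e that by (simp add: orthonormal_def)
  then show ?thesis using e by (auto simp: compress_family_def)
qed

lemma orthonormal_inj_on:
  assumes "orthonormal k e" shows "inj_on e {..<k}"
  using assms unfolding orthonormal_def inj_on_def by (metis lessThan_iff zero_neq_one)

lemma orthonormal_independent:
  assumes e: "orthonormal k e" shows "cv.independent (e ` {..<k})"
proof (rule cv.independent_if_scalars_zero)
  fix f x assume s: "(\<Sum>x\<in>e ` {..<k}. cscale (f x) x) = 0" and x: "x \<in> e ` {..<k}"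
  then obtain l where l: "l < k" "x = e l" by blast
  have "0 = cinner (\<Sum>i<k. cscale (f (e i)) (e i)) (e l)"
    using s by (simp add: sum.reindex[OF orthonormal_inj_on[OF e]])
  also have "\<dots> = (\<Sum>i<k. if i = l then f (e i) else 0)"
    unfolding cinner_sum_left
    by (rule sum.cong) (use e l in \<open>auto simp: orthonormal_def cinner_algebra\<close>)
  finally show "f x = 0" using l by (simp add: sum.delta)
qed simp

lemma Lambda_k_iff_family:
  assumes A: "\<forall>j. selfadjoint (A$j)"
  shows "a \<in> Lambda_k k A \<longleftrightarrow> (\<exists>e. compress_family k e A a)"
proof
  assume "a \<in> Lambda_k k A"
  then obtain P where "orth_proj P" "has_rank P k" "compress_cond P A a"
    unfolding Lambda_k_def by blast
  then show "\<exists>e. compress_family k e A a"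
    using range_orth_proj_family[of P A a "{}" k] has_rank_dim_ge[of P k] by auto
next
  assume "\<exists>e. compress_family k e A a"
  then obtain e where e: "orthonormal k e" and
    c: "\<And>i j l. i < k \<Longrightarrow> l < k \<Longrightarrow> cinner ((A$j) (e i)) (e l) = complex_of_real (a$j) * cinner (e i) (e l)"
    unfolding compress_family_def orthonormal_def by force
  obtain P where P: "orth_proj P" "range P = cv.span (e ` {..<k})"
    using orth_proj_finite_span[of "e ` {..<k}"] by blast
  have Aj: "selfadjoint (A$j)" for j using A by blast
  \<comment> \<open>The identity on basis vectors is extended to the span in one argument here, and
    in the other by the induction on \<open>x\<close> below.\<close>
  have c1: "cinner ((A$j) (e i) - cscale (complex_of_real (a$j)) (e i)) y = 0"
    if "i < k" "y \<in> range P" for i j y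
    using that(2) unfolding P(2)
    by (rule cinner_0_on_span) (use c that(1) in \<open>auto simp: cinner_algebra\<close>)
  have "cinner y ((A$j) x - cscale (complex_of_real (a$j)) x) = 0"
    if "x \<in> range P" "y \<in> range P" for j x y
    using that(1) unfolding P(2)
  proof (induction rule: cv.span_induct_alt)
    case base
    then show ?case by (simp add: selfadjoint_0[OF Aj])
  next
    case (step r z w)
    then have "cinner y ((A$j) z - cscale (complex_of_real (a$j)) z) = 0"
      using c1[OF _ that(2)] cinner_eq_0_commute by blast
    then show ?case
      using step by (simp add: cinner_algebra selfadjoint_add[OF Aj] selfadjoint_cscale[OF Aj] distrib_left mult.left_commute)
  qed
  then have "cinner ((A$j) x - cscale (complex_of_real (a$j)) x) y = 0"
    if "x \<in> range P" "y \<in> range P" for j x y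
    using that cinner_eq_0_commute by blast
  then have "compress_cond P A a"
    unfolding compress_cond_iff[OF P(1)] by (auto simp: cinner_algebra)
  moreover have "has_rank P k"
    unfolding has_rank_def cspan_eq_span cindependent_eq_independent
    using orthonormal_independent[OF e] P(2) card_image[OF orthonormal_inj_on[OF e]] by auto
  ultimately show "a \<in> Lambda_k k A" unfolding Lambda_k_def using P(1) by blast
qed

section \<open>The infinite-rank numerical range and star centers\<close>

lemma Lambda_inf_subset_Lambda_k:
  assumes "\<forall>j. selfadjoint (A$j)"
  shows "Lambda_inf A \<subseteq> Lambda_k k A"
proof
  fix a assume "a \<in> Lambda_inf A"
  then obtain P where "orth_proj P" "infinite_rank P" "compress_cond P A a"
    unfolding Lambda_inf_def by blast
  then show "a \<in> Lambda_k k A"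
    unfolding Lambda_k_iff_family[OF assms]
    using range_orth_proj_family[of P A a "{}" k] infinite_rank_dim_ge by auto
qed

text \<open>Orthogonality of the \<open>f i\<close> to all \<open>e l\<close> and
  \<open>(A$j) (e l)\<close>, with self-adjointness, kills every cross term. The square roots then
  contribute the weights \<open>1 - u\<close> and \<open>u\<close>, which sum to 1 and keep the
  family orthonormal.\<close>

lemma compress_family_mix:
  assumes A: "\<forall>j. selfadjoint (A$j)"
    and e: "compress_family k e A b" and f: "compress_family k f A a"
    and fe: "\<And>i l. i < k \<Longrightarrow> l < k \<Longrightarrow> cinner (f i) (e l) = 0"
    and fAe: "\<And>i j l. i < k \<Longrightarrow> l < k \<Longrightarrow> cinner (f i) ((A$j) (e l)) = 0"
    and u: "0 \<le> u" "u \<le> 1"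
  shows "compress_family k
    (\<lambda>i. cscale (complex_of_real (sqrt (1 - u))) (f i) + cscale (complex_of_real (sqrt u)) (e i))
    A ((1 - u) *\<^sub>R a + u *\<^sub>R b)"
proof -
  have s: "complex_of_real (sqrt (1 - u)) * (complex_of_real (sqrt (1 - u)) * z) = complex_of_real (1 - u) * z"
    "complex_of_real (sqrt u) * (complex_of_real (sqrt u) * z) = complex_of_real u * z" for z
    using u by (simp_all flip: mult.assoc of_real_mult)
  have Aj: "selfadjoint (A$j)" for j using A by blast
  have ef: "cinner (e i) (f l) = 0" "cinner ((A$j) (e i)) (f l) = 0" "cinner ((A$j) (f i)) (e l) = 0"
    if "i < k" "l < k" for i j l
    using fe fAe that cinner_eq_0_commute selfadjoint_cinner[OF Aj] by metis+
  show ?thesis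
    using e f
    unfolding compress_family_def orthonormal_def
    by (auto simp: cinner_algebra selfadjoint_add[OF Aj] selfadjoint_cscale[OF Aj] ef fe s
        distrib_left; simp add: s flip: of_real_mult of_real_add)
qed

lemma Lambda_inf_subset_star_centers:
  assumes A: "\<forall>j. selfadjoint (A$j)"
  shows "Lambda_inf A \<subseteq> star_centers (Lambda_k k A)"
proof
  fix a assume a: "a \<in> Lambda_inf A"
  then obtain P where P: "orth_proj P" "infinite_rank P" "compress_cond P A a"
    unfolding Lambda_inf_def by blast
  have "closed_segment a b \<subseteq> Lambda_k k A" if b: "b \<in> Lambda_k k A" for b
  proof
    fix c assume "c \<in> closed_segment a b"
    then obtain u where u: "0 \<le> u" "u \<le> 1" and c: "c = (1 - u) *\<^sub>R a + u *\<^sub>R b"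
      unfolding closed_segment_def by blast
    obtain e where e: "compress_family k e A b"
      using b Lambda_k_iff_family[OF A] by blast
    \<comment> \<open>Exactly the vectors that \<open>compress_family_mix\<close> needs
      \<open>f\<close> to avoid. The set is finite, and infinite rank leaves room beside it.\<close>
    define T where "T = e ` {..<k} \<union> (\<Union>j. (A$j) ` e ` {..<k})"
    have "finite T" unfolding T_def by auto
    then obtain f where f: "compress_family k f A a" "\<And>i. i < k \<Longrightarrow> f i \<in> orthocomp T"
      using range_orth_proj_family[OF P(1,3)] infinite_rank_dim_ge[OF P(2)] by blast
    have "cinner (f i) (e l) = 0" "cinner (f i) ((A$j) (e l)) = 0" if "i < k" "l < k" for i l j
    proof -
      have "e l \<in> T" "(A$j) (e l) \<in> T" using that(2) unfolding T_def by blast+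
      then show "cinner (f i) (e l) = 0" "cinner (f i) ((A$j) (e l)) = 0"
        using f(2)[OF that(1)] by (simp_all add: orthocomp_def)
    qed
    then show "c \<in> Lambda_k k A"
      unfolding c Lambda_k_iff_family[OF A]
      using compress_family_mix[OF A e f(1) _ _ u] by blast
  qed
  then show "a \<in> star_centers (Lambda_k k A)"
    unfolding star_centers_def using Lambda_inf_subset_Lambda_k[OF A] a by blast
qed

section \<open>From finite-rank compressions to perturbed numerical ranges\<close>

lemma Lambda_k_subset_joint_nr:
  fixes A :: "('a::complex_inner \<Rightarrow> 'a)^'m"
  assumes A: "\<forall>j. selfadjoint (A$j)" and F: "\<forall>j. selfadjoint (F$j) \<and> finite_rank (F$j)"
    and a: "a \<in> (\<Inter>k\<in>{1..}. Lambda_k k A)"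
  shows "a \<in> joint_nr (\<chi> j. (\<lambda>x. (A$j) x + (F$j) x))"
proof -
  obtain S where S: "\<And>j. finite (S j)" "\<And>j. range (F$j) \<subseteq> cv.span (S j)"
    using F unfolding finite_rank_def cspan_eq_span by metis
  define T where "T = (\<Union>j. S j)"
  have T: "finite T" unfolding T_def using S(1) by auto
  \<comment> \<open>One dimension survives after imposing orthogonality to \<open>T\<close>, whose
    span contains the range of every \<open>F$j\<close>.\<close>
  obtain P where P: "orth_proj P" "has_rank P (1 + card T)" "compress_cond P A a"
    using a unfolding Lambda_k_def by auto
  obtain e where e: "compress_family 1 e A a" "e 0 \<in> orthocomp T"
    using range_orth_proj_family[OF P(1,3) T has_rank_dim_ge[OF P(2)]] by auto
  have e1: "norm (e 0) = 1"
    using e(1) cinner_self[of "e 0"] norm_ge_zero[of "e 0"]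
    by (simp add: compress_family_def orthonormal_def power2_eq_1_iff del: norm_ge_zero flip: of_real_power)
  \<comment> \<open>For self-adjoint \<open>F$j\<close>, a vector orthogonal to the range lies in
    the kernel.\<close>
  have "(F$j) (e 0) = 0" for j
  proof -
    have Fj: "selfadjoint (F$j)" using F by blast
    have "cinner ((F$j) (e 0)) ((F$j) (e 0)) = cinner (e 0) ((F$j) ((F$j) (e 0)))"
      by (rule selfadjoint_cinner[OF Fj])
    also have "\<dots> = 0"
      by (rule cinner_0_on_span[of _ "S j"]) (use S(2) e(2) in \<open>auto simp: orthocomp_def T_def\<close>)
    finally show ?thesis by simp
  qed
  then have "a = (\<chi> j. Re (cinner (((\<chi> j. (\<lambda>x. (A$j) x + (F$j) x)) $ j) (e 0)) (e 0)))"
    using e(1) by (simp add: vec_eq_iff compress_family_def)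
  then show ?thesis unfolding joint_nr_def using e1 by blast
qed

section \<open>Finite-rank perturbations\<close>

text \<open>\<open>F\<close> is chosen so that \<open>A + F\<close> equals
  \<open>(1 - Q) A (1 - Q) + c Q\<close>: block diagonal, unchanged on the complement of
  \<open>range Q\<close>, and the scalar \<open>c\<close> on \<open>range Q\<close>.\<close>

lemma finite_rank_compression_perturbation:
  fixes A :: "'a::complex_inner \<Rightarrow> 'a" and c :: real
  assumes A: "selfadjoint A" and Q: "orth_proj Q" "range Q = cv.span T" and T: "finite T"
  defines "F \<equiv> \<lambda>x. Q (A (Q x)) - Q (A x) - A (Q x) + cscale (complex_of_real c) (Q x)"
  shows "selfadjoint F" "finite_rank F"
    and "cinner (A x + F x) x =
      cinner (A (x - Q x)) (x - Q x) + complex_of_real (c * (norm (Q x))\<^sup>2)"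
proof -
  have sQ: "selfadjoint Q" and QQ: "\<And>z. Q (Q z) = Q z" using Q(1) by (auto simp: orth_proj_def)
  note bl = selfadjoint_bounded_linear[OF A] selfadjoint_bounded_linear[OF sQ]
  note lin = selfadjoint_add[OF A] selfadjoint_add[OF sQ] selfadjoint_cscale[OF A]
    selfadjoint_cscale[OF sQ]
  have "bounded_linear F"
    unfolding F_def
    by (intro bounded_linear_add bounded_linear_sub bounded_linear_compose[OF bounded_linear_cscale]
        bounded_linear_compose[OF bl(2)] bounded_linear_compose[OF bl(1)] bl)
  then have bF: "bounded_clinear_op F"
    unfolding bounded_clinear_op_def
    using bounded_linear.bounded[of F]
    by (auto simp: F_def lin cv.scale_right_diff_distrib cscale_add_right cscale_cscale mult.commute)
  have "cinner (F x) y = cinner x (F y)" for x y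
    unfolding F_def
    by (simp add: cinner_algebra selfadjoint_cinner[OF A] selfadjoint_cinner[OF sQ])
  then show "selfadjoint F" unfolding selfadjoint_def using bF by blast
  have "F x \<in> cv.span (T \<union> A ` T)" for x
  proof -
    have Qs: "Q z \<in> cv.span (T \<union> A ` T)" for z
      using Q(2) cv.span_mono[of T "T \<union> A ` T"] by blast
    have "A w \<in> cv.span (T \<union> A ` T)" if "w \<in> cv.span T" for w
      using that
    proof (induction rule: cv.span_induct_alt)
      case base
      then show ?case by (simp add: selfadjoint_0[OF A] cv.span_zero)
    next
      case (step r z w)
      then show ?case by (auto simp: lin intro!: cv.span_add cv.span_scale intro: cv.span_base)
    qed
    then have "A (Q x) \<in> cv.span (T \<union> A ` T)" using Q(2) by blast
    then show ?thesis unfolding F_def by (intro cv.span_add cv.span_diff cv.span_scale Qs)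
  qed
  then show "finite_rank F"
    unfolding finite_rank_def cspan_eq_span using bF T
    by (intro conjI exI[of _ "T \<union> A ` T"]) auto
  have "complex_of_real (c * (norm (Q x))\<^sup>2) = complex_of_real c * cinner (Q x) x"
    using selfadjoint_cinner[OF sQ, of "Q x" x] cinner_self[of "Q x"] by (simp add: QQ)
  moreover have "cinner (A (x - Q x)) (x - Q x) = cinner (A x + (F x - cscale (complex_of_real c) (Q x))) x"
    unfolding F_def
    by (simp add: cinner_algebra selfadjoint_diff[OF A] selfadjoint_cinner[OF sQ])
  ultimately show "cinner (A x + F x) x =
      cinner (A (x - Q x)) (x - Q x) + complex_of_real (c * (norm (Q x))\<^sup>2)"
    by (simp add: cinner_algebra)
qed

definition in_all_joint_nr :: "('a::complex_inner \<Rightarrow> 'a)^'m \<Rightarrow> real^'m \<Rightarrow> bool" where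
  "in_all_joint_nr A a \<longleftrightarrow>
    (\<forall>F. (\<forall>j. selfadjoint (F$j) \<and> finite_rank (F$j)) \<longrightarrow>
      a \<in> joint_nr (\<chi> j. (\<lambda>x. (A$j) x + (F$j) x)))"

text \<open>Perturbing \<open>A\<close> so that it becomes block diagonal with respect to the span of \<open>T\<close> and its
  complement, with the scalar tuple \<open>a + r (1, \<dots>, 1)\<close> on the span of \<open>T\<close>, forces
  the compression of \<open>A\<close> to the complement to attain a value on the ray opposite to \<open>r\<close>.\<close>

lemma joint_nr_ray:
  fixes A :: "('a::complex_inner \<Rightarrow> 'a)^'m"
  assumes A: "\<forall>j. selfadjoint (A$j)" and a: "in_all_joint_nr A a"
    and T: "finite T" and r: "r \<noteq> 0"
  shows "\<exists>v s. norm v = 1 \<and> v \<in> orthocomp T \<and> 0 \<le> s \<and>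
    (\<forall>j. cinner ((A$j) v) v = complex_of_real (a$j - s * r))"
proof -
  obtain Q where Q: "orth_proj Q" "range Q = cv.span T" using orth_proj_finite_span[OF T] .
  have Aj: "selfadjoint (A$j)" for j using A by blast
  define F :: "('a \<Rightarrow> 'a)^'m" where "F = (\<chi> j. (\<lambda>x. Q ((A$j) (Q x)) - Q ((A$j) x) - (A$j) (Q x)
    + cscale (complex_of_real (a$j + r)) (Q x)))"
  note pert = finite_rank_compression_perturbation[OF Aj Q T]
  have "\<forall>j. selfadjoint (F$j) \<and> finite_rank (F$j)"
    unfolding F_def by (simp add: pert(1,2) del: of_real_add)
  then have "a \<in> joint_nr (\<chi> j. (\<lambda>x. (A$j) x + (F$j) x))"
    using a unfolding in_all_joint_nr_def by blast
  then obtain x where x: "norm x = 1" and ax: "\<And>j. a$j = Re (cinner ((A$j) x + (F$j) x) x)"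
    unfolding joint_nr_def by auto
  define v where "v = x - Q x"
  define q where "q = (norm (Q x))\<^sup>2"
  have Av: "Re (cinner ((A$j) v) v) = a$j - (a$j + r) * q" for j
    using ax[of j] finite_rank_compression_perturbation(3)[OF Aj[of j] Q T, where c = "a$j + r" and x = x] by (simp add: F_def v_def q_def)
  have nq: "(norm v)\<^sup>2 + q = 1"
    using norm_add_cinner_0[OF orth_proj_cinner_diff[OF Q(1), of x x]] x by (simp add: v_def q_def)
  \<comment> \<open>Otherwise \<open>q = 1\<close> and \<open>Av\<close> would read
    \<open>0 = - r\<close> for any index \<open>j\<close>.\<close>
  have "v \<noteq> 0"
  proof
    assume "v = 0"
    then have "q = 1" using nq by simp
    moreover have "Re (cinner ((A$j) v) v) = 0" for j using \<open>v = 0\<close> by simp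
    ultimately show False using Av r by simp
  qed
  define n where "n = norm v"
  have n: "n > 0" "n\<^sup>2 = 1 - q" using \<open>v \<noteq> 0\<close> nq by (auto simp: n_def)
  define w where "w = cscale (complex_of_real (1 / n)) v"
  have "norm w = 1" using n(1) by (simp add: w_def norm_cscale n_def norm_divide)
  moreover have "w \<in> orthocomp T"
  proof -
    have "cinner v t = 0" if "t \<in> T" for t
    proof -
      have "t \<in> range Q" using that Q(2) cv.span_base by blast
      then show ?thesis unfolding v_def using orth_proj_cinner_diff[OF Q(1)] by blast
    qed
    then show ?thesis by (simp add: orthocomp_def w_def cinner_algebra)
  qed
  \<comment> \<open>Normalising divides \<open>a$j * (1 - q) - q * r\<close> by
    \<open>n\<^sup>2 = 1 - q\<close>, so the ray parameter is
    \<open>s = q / n\<^sup>2\<close>.\<close>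
  moreover have "cinner ((A$j) w) w = complex_of_real (a$j - (q / n\<^sup>2) * r)" for j
  proof -
    have "cinner ((A$j) w) w = complex_of_real ((1 / n) * (1 / n)) * cinner ((A$j) v) v"
      unfolding w_def selfadjoint_cscale[OF Aj] by (simp add: cinner_algebra)
    also have "\<dots> = complex_of_real ((1 / n) * (1 / n)) * complex_of_real (Re (cinner ((A$j) v) v))"
      by (rule arg_cong[OF selfadjoint_cinner_real[OF Aj]])
    also have "\<dots> = complex_of_real ((1 / n\<^sup>2) * (a$j - (a$j + r) * q))"
      unfolding Av by (simp add: power2_eq_square)
    also have "a$j - (a$j + r) * q = a$j * n\<^sup>2 - q * r"
      unfolding n(2) by (simp add: algebra_simps)
    also have "(1 / n\<^sup>2) * (a$j * n\<^sup>2 - q * r) = a$j - (q / n\<^sup>2) * r"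
      using n(1) by (simp add: field_simps)
    finally show ?thesis .
  qed
  moreover have "0 \<le> q / n\<^sup>2" by (simp add: q_def)
  ultimately show ?thesis by blast
qed

text \<open>Orthogonal vectors for the opposite rays \<open>r = 1\<close> and \<open>r = - 1\<close> combine to a vector
  attaining \<open>a\<close> itself.\<close>

lemma joint_nr_attained_in_orthocomp:
  fixes A :: "('a::complex_inner \<Rightarrow> 'a)^'m"
  assumes A: "\<forall>j. selfadjoint (A$j)" and a: "in_all_joint_nr A a" and T: "finite T"
  shows "\<exists>x. norm x = 1 \<and> x \<in> orthocomp T \<and> (\<forall>j. cinner ((A$j) x) x = complex_of_real (a$j))"
proof -
  have Aj: "selfadjoint (A$j)" for j using A by blast
  obtain v s where v: "norm v = 1" "v \<in> orthocomp T" and s: "0 \<le> s"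
    and Av: "\<And>j. cinner ((A$j) v) v = complex_of_real (a$j - s)"
    using joint_nr_ray[OF A a T, of 1] by auto
  \<comment> \<open>Including \<open>v\<close> and all \<open>(A$j) v\<close> makes the cross terms
    between \<open>v\<close> and the second vector \<open>w\<close> vanish.\<close>
  define T' where "T' = T \<union> insert v (range (\<lambda>j. (A$j) v))"
  have "finite T'" unfolding T'_def using T by simp
  then obtain w t where w: "norm w = 1" "w \<in> orthocomp T'" and t: "0 \<le> t"
    and Aw: "\<And>j. cinner ((A$j) w) w = complex_of_real (a$j + t)"
    using joint_nr_ray[OF A a, of T' "- 1"] by auto
  have wv: "cinner w v = 0" and wAv: "cinner w ((A$j) v) = 0" for j
    using w(2) unfolding orthocomp_def T'_def by blast+
  have wT: "w \<in> orthocomp T" using w(2) unfolding T'_def orthocomp_Un by blast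
  show ?thesis
  proof (cases "s = 0")
    case True
    then show ?thesis using v Av by auto
  next
    case False
    \<comment> \<open>The weight at which the deviations \<open>- s\<close> and \<open>t\<close>
      cancel; \<open>s + t\<close> is positive because \<open>s = 0\<close>, where \<open>v\<close>
      already works, is excluded.\<close>
    define \<alpha> where "\<alpha> = t / (s + t)"
    have "\<alpha> * (s + t) = t" using False s t by (simp add: \<alpha>_def)
    then have "\<alpha> * (a$j - s) + (1 - \<alpha>) * (a$j + t) = a$j" for j by (simp add: algebra_simps)
    moreover have "0 \<le> \<alpha>" "\<alpha> \<le> 1" using s t by (auto simp: \<alpha>_def divide_le_eq_1)
    ultimately have \<alpha>: "0 \<le> \<alpha>" "\<alpha> \<le> 1" "\<alpha> * (a$j - s) + (1 - \<alpha>) * (a$j + t) = a$j" for j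
      by blast+
    define p where "p = complex_of_real (sqrt \<alpha>)"
    define q where "q = complex_of_real (sqrt (1 - \<alpha>))"
    have pq: "p * (p * z) = complex_of_real \<alpha> * z" "q * (q * z) = complex_of_real (1 - \<alpha>) * z"
      "cnj p = p" "cnj q = q" "p * p = complex_of_real \<alpha>" "q * q = complex_of_real (1 - \<alpha>)" for z
      using \<alpha>(1,2) by (simp_all add: p_def q_def flip: mult.assoc of_real_mult)
    define x where "x = cscale p v + cscale q w"
    have vw: "cinner v w = 0" "cinner ((A$j) v) w = 0" "cinner ((A$j) w) v = 0" for j
      using wv wAv cinner_eq_0_commute[of w v] cinner_eq_0_commute[of w "(A$j) v"]
        selfadjoint_cinner[OF Aj, of j w v] by simp_all
    have "cinner x x = complex_of_real \<alpha> * cinner v v + complex_of_real (1 - \<alpha>) * cinner w w"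
      by (simp add: x_def cinner_algebra vw wv pq)
    also have "\<dots> = 1" by (simp add: cinner_self v(1) w(1))
    finally have "norm x = 1"
      using norm_ge_zero[of x]
      by (simp add: cinner_self power2_eq_1_iff del: norm_ge_zero flip: of_real_power)
    moreover have "x \<in> orthocomp T"
      unfolding x_def by (intro cv.subspace_add cv.subspace_scale orthocomp_subspace v(2) wT)
    moreover have "cinner ((A$j) x) x = complex_of_real (a$j)" for j
    proof -
      have "cinner ((A$j) x) x = complex_of_real \<alpha> * complex_of_real (a$j - s) +
          complex_of_real (1 - \<alpha>) * complex_of_real (a$j + t)"
        by (simp add: x_def cinner_algebra selfadjoint_add[OF Aj] selfadjoint_cscale[OF Aj]
            vw pq Av Aw del: of_real_diff of_real_add)
      also have "\<dots> = complex_of_real (\<alpha> * (a$j - s) + (1 - \<alpha>) * (a$j + t))"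
        by (simp only: of_real_add of_real_mult)
      finally show ?thesis by (simp only: \<alpha>(3))
    qed
    ultimately show ?thesis by blast
  qed
qed

section \<open>Maximal subspaces with scalar compression\<close>

definition scalar_subspaces :: "('a::complex_inner \<Rightarrow> 'a)^'m \<Rightarrow> real^'m \<Rightarrow> 'a set set" where
  "scalar_subspaces A a = {M. cv.subspace M \<and>
    (\<forall>j. \<forall>x\<in>M. \<forall>y\<in>M. cinner ((A$j) x) y = complex_of_real (a$j) * cinner x y)}"

text \<open>Zorn's lemma applies because every condition involves at most two vectors at a time, and
  two vectors in the union of a chain lie in a common member.\<close>

lemma scalar_subspaces_maximal:
  "\<exists>M\<in>scalar_subspaces A a. \<forall>X\<in>scalar_subspaces A a. M \<subseteq> X \<longrightarrow> X = M"
proof (rule subset_Zorn_nonempty)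
  have "cv.span {} \<in> scalar_subspaces A a" by (simp add: scalar_subspaces_def cv.subspace_def)
  then show "scalar_subspaces A a \<noteq> {}" by blast
  fix C assume "C \<noteq> {}" and ch: "subset.chain (scalar_subspaces A a) C"
  have C: "M \<in> scalar_subspaces A a" if "M \<in> C" for M
    using ch that by (auto simp: subset_chain_def)
  have two: "\<exists>M\<in>C. x \<in> M \<and> y \<in> M" if "x \<in> \<Union>C" "y \<in> \<Union>C" for x y
    using ch that unfolding subset_chain_def by blast
  have "cv.subspace (\<Union>C)"
    unfolding cv.subspace_def
  proof (intro conjI ballI allI)
    show "0 \<in> \<Union>C"
      using \<open>C \<noteq> {}\<close> C by (auto simp: scalar_subspaces_def cv.subspace_def)
    fix x y c assume xy: "x \<in> \<Union>C" "y \<in> \<Union>C"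
    obtain M where M: "M \<in> C" "x \<in> M" "y \<in> M" using two[OF xy] by blast
    have "cv.subspace M" using C[OF M(1)] by (simp add: scalar_subspaces_def)
    then have "x + y \<in> M" "cscale c x \<in> M"
      using M by (simp_all add: cv.subspace_add cv.subspace_scale)
    then show "x + y \<in> \<Union>C" "cscale c x \<in> \<Union>C" using M(1) by blast+
  qed
  moreover have "cinner ((A$j) x) y = complex_of_real (a$j) * cinner x y"
    if "x \<in> \<Union>C" "y \<in> \<Union>C" for j x y
    using two[OF that] C by (auto simp: scalar_subspaces_def)
  ultimately show "\<Union>C \<in> scalar_subspaces A a" by (simp add: scalar_subspaces_def)
qed

text \<open>Continuity carries the defining identity to limits. A maximal member therefore equals
  its closure, which provides the projection onto it.\<close>

lemma scalar_subspaces_closure: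
  assumes A: "\<forall>j. selfadjoint (A$j)" and M: "M \<in> scalar_subspaces A a"
  shows "closure M \<in> scalar_subspaces A a"
proof -
  have sM: "cv.subspace M" using M by (simp add: scalar_subspaces_def)
  have "cv.subspace (closure M)"
    unfolding cv.subspace_def
  proof (intro conjI ballI allI)
    show "0 \<in> closure M" using cv.subspace_0[OF sM] closure_subset by blast
    fix x y c assume "x \<in> closure M" "y \<in> closure M"
    then obtain f g where f: "\<forall>n. f n \<in> M" "f \<longlonglongrightarrow> x" and g: "\<forall>n. g n \<in> M" "g \<longlonglongrightarrow> y"
      unfolding closure_sequential by (elim exE conjE)
    show "x + y \<in> closure M"
      unfolding closure_sequential
      using f g tendsto_add[OF f(2) g(2)] cv.subspace_add[OF sM]
      by (intro exI[of _ "\<lambda>n. f n + g n"]) auto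
    show "cscale c x \<in> closure M"
      unfolding closure_sequential
      using f bounded_linear.tendsto[OF bounded_linear_cscale f(2)] cv.subspace_scale[OF sM]
      by (intro exI[of _ "\<lambda>n. cscale c (f n)"]) auto
  qed
  moreover have "cinner ((A$j) x) y = complex_of_real (a$j) * cinner x y"
    if xy: "x \<in> closure M" "y \<in> closure M" for j x y
  proof -
    obtain f g where f: "\<forall>n. f n \<in> M" "f \<longlonglongrightarrow> x" and g: "\<forall>n. g n \<in> M" "g \<longlonglongrightarrow> y"
      using xy unfolding closure_sequential by (elim exE conjE)
    have "(\<lambda>n. cinner ((A$j) (f n)) (g n)) \<longlonglongrightarrow> cinner ((A$j) x) y"
      by (rule tendsto_cinner[OF
            bounded_linear.tendsto[OF selfadjoint_bounded_linear[OF A[rule_format]] f(2)] g(2)])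
    moreover have "cinner ((A$j) (f n)) (g n) = complex_of_real (a$j) * cinner (f n) (g n)" for n
      using M f(1) g(1) by (simp add: scalar_subspaces_def)
    moreover have "(\<lambda>n. complex_of_real (a$j) * cinner (f n) (g n))
        \<longlonglongrightarrow> complex_of_real (a$j) * cinner x y"
      by (intro tendsto_mult tendsto_const tendsto_cinner f(2) g(2))
    ultimately show ?thesis using LIMSEQ_unique by simp
  qed
  ultimately show ?thesis by (simp add: scalar_subspaces_def)
qed

text \<open>Expanding the form on \<open>cscale c x + u\<close> and \<open>cscale d x + w\<close>
  with \<open>u\<close>, \<open>w\<close> in \<open>M\<close>, the mixed terms vanish by
  orthogonality, leaving the identities on \<open>x\<close> and on \<open>M\<close>.\<close>

lemma scalar_subspaces_extend:
  assumes A: "\<forall>j. selfadjoint (A$j)" and M: "M \<in> scalar_subspaces A a"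
    and x: "x \<in> orthocomp M" "\<And>j. x \<in> orthocomp ((A$j) ` M)"
    and Ax: "\<And>j. cinner ((A$j) x) x = complex_of_real (a$j) * cinner x x"
  shows "cv.span (insert x M) \<in> scalar_subspaces A a"
proof -
  have Aj: "selfadjoint (A$j)" for j using A by blast
  have sM: "cv.span M = M" using M by (simp add: scalar_subspaces_def cv.span_eq_iff)
  have xM: "cinner x y = 0" "cinner y x = 0" "cinner ((A$j) x) y = 0" "cinner ((A$j) y) x = 0"
    if "y \<in> M" for y j
  proof -
    show "cinner x y = 0" "cinner y x = 0"
      using x(1) that cinner_eq_0_commute unfolding orthocomp_def by blast+
    have "cinner x ((A$j) y) = 0" using x(2)[of j] that unfolding orthocomp_def by blast
    then show "cinner ((A$j) x) y = 0" "cinner ((A$j) y) x = 0"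
      using selfadjoint_cinner[OF Aj, of j x y] cinner_eq_0_commute[of x "(A$j) y"] by simp_all
  qed
  have "cinner ((A$j) y) z = complex_of_real (a$j) * cinner y z"
    if y: "y \<in> cv.span (insert x M)" and z: "z \<in> cv.span (insert x M)" for j y z
  proof -
    have dec: "\<exists>c u. u \<in> M \<and> y = cscale c x + u" if y': "y \<in> cv.span (insert x M)" for y
    proof -
      obtain c where "y - cscale c x \<in> M" using y' unfolding cv.span_breakdown_eq sM by blast
      then show ?thesis by (intro exI[of _ c] exI[of _ "y - cscale c x"]) simp
    qed
    obtain c u where u: "u \<in> M" "y = cscale c x + u" using dec[OF y] by blast
    obtain d w where w: "w \<in> M" "z = cscale d x + w" using dec[OF z] by blast
    have "cinner ((A$j) u) w = complex_of_real (a$j) * cinner u w"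
      using M u(1) w(1) by (simp add: scalar_subspaces_def)
    then show ?thesis
      unfolding u(2) w(2)
      by (simp add: cinner_algebra selfadjoint_add[OF Aj] selfadjoint_cscale[OF Aj]
          xM[OF u(1)] xM[OF w(1)] Ax distrib_left mult.left_commute)
  qed
  then show ?thesis by (simp add: scalar_subspaces_def)
qed

lemma in_all_joint_nr_imp_Lambda_inf:
  fixes A :: "('a::chilbert_space \<Rightarrow> 'a)^'m"
  assumes A: "\<forall>j. selfadjoint (A$j)" and a: "in_all_joint_nr A a"
  shows "a \<in> Lambda_inf A"
proof -
  have Aj: "selfadjoint (A$j)" for j using A by blast
  obtain M where M: "M \<in> scalar_subspaces A a"
    and mx: "\<forall>X\<in>scalar_subspaces A a. M \<subseteq> X \<longrightarrow> X = M"
    using scalar_subspaces_maximal[of A a] by (elim bexE)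
  have "closure M = M"
    using mx[rule_format, OF scalar_subspaces_closure[OF A M] closure_subset] .
  then have "closed M" by (metis closed_closure)
  moreover have sM: "cv.subspace M" using M by (simp add: scalar_subspaces_def)
  ultimately obtain P where P: "orth_proj P" "range P = M"
    using orth_proj_closed_subspace by blast
  have "compress_cond P A a"
    unfolding compress_cond_iff[OF P(1)] P(2) using M by (simp add: scalar_subspaces_def)
  moreover have "infinite_rank P"
    unfolding infinite_rank_def cspan_eq_span P(2)
  proof
    assume "\<exists>S. finite S \<and> M \<subseteq> cv.span S"
    then obtain S where S: "finite S" "M \<subseteq> cv.span S" by blast
    \<comment> \<open>The finite set \<open>S\<close> stands in for \<open>M\<close>: orthogonality
      to \<open>S\<close> and to all \<open>(A$j) s\<close> extends by linearity to \<open>M\<close>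
      and all \<open>(A$j) y\<close>.\<close>
    define T where "T = S \<union> (\<Union>j. (A$j) ` S)"
    have "finite T" unfolding T_def using S(1) by simp
    then obtain x where x: "norm x = 1" "x \<in> orthocomp T"
      and Ax: "\<And>j. cinner ((A$j) x) x = complex_of_real (a$j)"
      using joint_nr_attained_in_orthocomp[OF A a] by blast
    have xx: "cinner x x = 1" by (simp add: cinner_self x(1))
    have xS: "cinner x s = 0" "cinner ((A$j) x) s = 0" if "s \<in> S" for s j
    proof -
      have "s \<in> T" "(A$j) s \<in> T" using that unfolding T_def by blast+
      then show "cinner x s = 0" "cinner ((A$j) x) s = 0"
        using x(2) selfadjoint_cinner[OF Aj] by (simp_all add: orthocomp_def)
    qed
    have "cinner x y = 0" "cinner ((A$j) x) y = 0" if "y \<in> M" for y j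
      using cinner_0_on_span[of y S] xS S(2) that by blast+
    then have "x \<in> orthocomp M" "\<And>j. x \<in> orthocomp ((A$j) ` M)"
      by (auto simp: orthocomp_def simp flip: selfadjoint_cinner[OF Aj])
    then have "cv.span (insert x M) \<in> scalar_subspaces A a"
      by (rule scalar_subspaces_extend[OF A M]) (simp add: Ax xx)
    \<comment> \<open>Maximality puts \<open>x\<close> into \<open>M\<close>, although the unit
      vector \<open>x\<close> is orthogonal to \<open>M\<close>.\<close>
    then have "cv.span (insert x M) = M"
      by (rule mx[rule_format]) (use cv.span_superset[of "insert x M"] in blast)
    then have "x \<in> M" using cv.span_base[of x "insert x M"] by blast
    then show False using \<open>x \<in> orthocomp M\<close> xx by (simp add: orthocomp_def)
  qed
  ultimately show ?thesis unfolding Lambda_inf_def using P(1) by blast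
qed

section \<open>Closing the chain of inclusions\<close>

theorem theorem4p2:
  fixes A :: "('a::chilbert_space \<Rightarrow> 'a)^'m"
  assumes "infinite_dimensional TYPE('a)"
    and "\<forall>j. selfadjoint (A$j)"
  shows "Lambda_inf A = (\<Inter>k\<in>{1..}. star_centers (Lambda_k k A))
    \<and> (\<Inter>k\<in>{1..}. star_centers (Lambda_k k A)) = (\<Inter>k\<in>{1..}. Lambda_k k A)
    \<and> (\<Inter>k\<in>{1..}. Lambda_k k A) =
        \<Inter>{joint_nr (\<chi> j. (\<lambda>x. (A$j) x + (F$j) x)) | F.
              \<forall>j. selfadjoint (F$j) \<and> finite_rank (F$j)}
    \<and> convex (Lambda_inf A)"
proof -
  let ?S = "\<Inter>k\<in>{1..}. star_centers (Lambda_k k A)"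
  let ?L = "\<Inter>k\<in>{1..}. Lambda_k k A"
  let ?W = "\<Inter>{joint_nr (\<chi> j. (\<lambda>x. (A$j) x + (F$j) x)) | F.
              \<forall>j. selfadjoint (F$j) \<and> finite_rank (F$j)}"
  have 1: "Lambda_inf A \<subseteq> ?S"
    using Lambda_inf_subset_star_centers[OF assms(2)] by blast
  have 2: "?S \<subseteq> ?L" unfolding star_centers_def by blast
  have 3: "?L \<subseteq> ?W"
    using Lambda_k_subset_joint_nr[OF assms(2)] by blast
  have 4: "?W \<subseteq> Lambda_inf A"
  proof
    fix a assume "a \<in> ?W"
    then have "in_all_joint_nr A a" unfolding in_all_joint_nr_def by blast
    then show "a \<in> Lambda_inf A" by (rule in_all_joint_nr_imp_Lambda_inf[OF assms(2)])
  qed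
  have "convex (Lambda_inf A)"
    unfolding convex_contains_segment
  proof (intro ballI)
    fix a b assume a: "a \<in> Lambda_inf A" and b: "b \<in> Lambda_inf A"
    \<comment> \<open>For every \<open>k\<close>, \<open>a\<close> is a star center of
      \<open>Lambda_k k A\<close> and \<open>b\<close> a point of it; the inclusions
      \<open>3\<close> and \<open>4\<close> then bring the segment back into
      \<open>Lambda_inf A\<close>.\<close>
    have "closed_segment a b \<subseteq> Lambda_k k A" for k
      using Lambda_inf_subset_star_centers[OF assms(2), of k]
        Lambda_inf_subset_Lambda_k[OF assms(2), of k] a b
      unfolding star_centers_def by auto
    then have "closed_segment a b \<subseteq> ?L" by (rule INT_greatest)
    then show "closed_segment a b \<subseteq> Lambda_inf A" by (rule subset_trans[OF _ subset_trans[OF 3 4]])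
  qed
  moreover have "Lambda_inf A = ?S"
    by (rule subset_antisym[OF 1 subset_trans[OF 2 subset_trans[OF 3 4]]])
  moreover have "?S = ?L"
    by (rule subset_antisym[OF 2 subset_trans[OF 3 subset_trans[OF 4 1]]])
  moreover have "?L = ?W"
    by (rule subset_antisym[OF 3 subset_trans[OF 4 subset_trans[OF 1 2]]])
  ultimately show ?thesis by (intro conjI)
qed

end
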